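(* Let $X$ be a symmetric real random variable whose characteristic function $\phi(z)=\mathbb{E}[e^{izX}]$ is strictly positive on $\mathbb{R}$. Let $\Psi:=-\log\phi$, and assume that $\Psi\in C^1(\mathbb{R}\setminus\{0\})$ and that $$\lim_{z\to 0}z\Psi'(z)=0,\qquad \lim_{z\to+\infty}z\Psi'(z)=L\in(0,\infty).$$ Define $J:\mathbb{R}\to\mathbb{R}$ by $$J(0)=1,\qquad J(z):=1-\frac{z\Psi'(z)}{L}\quad\text{for } z\neq 0.$$ Then: (i) $X$ is self-decomposable if and only if $J$ is the characteristic function of a symmetric probability measure on $\mathbb{R}$ with no atom at zero. (ii) If $X$ is self-decomposable and $\int_{\mathbb{R}}|J(z)|\,dz<\infty$, then $\int_{\mathbb{R}}J(z)\,dz\ge 0$.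
   Context: A real random variable $X$ is self-decomposable if for every $c\in(0,1)$ there is a random variable $X_c$ such that $X\overset{d}{=}cX'+X_c$ (equality in distribution), where $X'$ has the same distribution as $X$ and is independent of $X_c$. A random variable $X$ is symmetric if $X\overset{d}{=}-X$; a probability measure $\mu$ on $\mathbb{R}$ is symmetric if $\mu(B)=\mu(-B)$ for all Borel sets $B$. *)

theory Defs
  imports "HOL-Probability.Probability"
begin

definition symmetric_rv :: "'a measure \<Rightarrow> ('a \<Rightarrow> real) \<Rightarrow> bool" where
  "symmetric_rv M X \<longleftrightarrow> distr M borel X = distr M borel (\<lambda>\<omega>. - X \<omega>)"

definition symmetric_measure :: "real measure \<Rightarrow> bool" where
  "symmetric_measure \<mu> \<longleftrightarrow> (\<forall>B\<in>sets borel. measure \<mu> B = measure \<mu> (uminus ` B))"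

(* The auxiliary variables X' and Xc may live on any probability space N. HOL cannot quantify
   over the type of its points, so N is taken over pairs of reals. This loses nothing: only the
   joint law of (X', Xc) matters, and it is realised by the two projections on real * real. *)
definition self_decomposable :: "'a measure \<Rightarrow> ('a \<Rightarrow> real) \<Rightarrow> bool" where
  "self_decomposable M X \<longleftrightarrow>
    (\<forall>c\<in>{0<..<1}. \<exists>(N :: (real \<times> real) measure) X' Xc.
       prob_space N \<and> X' \<in> borel_measurable N \<and> Xc \<in> borel_measurable N \<and>
       prob_space.indep_var N borel X' borel Xc \<and>
       distr N borel X' = distr M borel X \<and>
       distr M borel X = distr N borel (\<lambda>\<omega>. c * X' \<omega> + Xc \<omega>))"

definition J_fun :: "(real \<Rightarrow> real) \<Rightarrow> real \<Rightarrow> real \<Rightarrow> real" where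
  "J_fun \<Psi> L z = (if z = 0 then 1 else 1 - z * deriv \<Psi> z / L)"

end

theory Submission
  imports Defs
begin

text \<open>
  Write \<open>\<psi> z = z * \<Psi>' z\<close>, so that \<open>J = 1 - \<psi> / L\<close>. Since \<open>\<phi>\<close> has no zeros, \<open>X\<close> is
  self-decomposable exactly when each quotient \<open>\<phi> z / \<phi> (c * z) = exp (\<Psi> (c * z) - \<Psi> z)\<close>
  with \<open>0 < c < 1\<close> is a characteristic function. The function \<open>exp (- \<psi>)\<close> is the limit of
  the \<open>n\<close>-th powers of these quotients at \<open>c = 1 - 1/n\<close>, hence infinitely divisible, and its
  exponent stays bounded with limit \<open>L\<close>. It is therefore compound Poisson with rate \<open>L\<close>, and \<open>J\<close>
  is the characteristic function of its jumps. Weighted laws and limits of explicit characteristic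
  functions turn this heuristic into a proof.

  If \<open>X\<close> is self-decomposable, the laws of the remainders \<open>X\<^sub>c\<close>, divided by \<open>1 - c\<close>, approach
  the jump measure only away from the origin, as most of their mass collapses to \<open>0\<close>. Weighting
  them by \<open>1 - cos (T * x)\<close> removes this mass and leaves, after normalization, characteristic
  functions that converge for \<open>c \<rightarrow> 1\<close> to
  \<open>((\<psi> (z + T) + \<psi> (z - T)) / 2 - \<psi> z) / \<psi> T\<close>. For \<open>T \<rightarrow> \<infinity>\<close> this tends to
  \<open>(L - \<psi> z) / L = J z\<close>. This is \<open>real_cf_log_derivative\<close>.

  Conversely let \<open>J\<close> be the characteristic function of \<open>\<mu>\<close>, and let \<open>a = - ln c\<close>. Integrating
  \<open>\<Psi>'\<close> from \<open>c * z\<close> to \<open>z\<close> in logarithmic coordinates gives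
  \<open>\<Psi> z - \<Psi> (c * z) = L * \<integral>\<^sub>0\<^sup>a (1 - J (exp (- u) * z)) du\<close>. The quotient is thus the
  characteristic function of a compound Poisson law whose jumps are distributed as \<open>exp (- U) * Y\<close>
  with \<open>Y\<close> of law \<open>\<mu>\<close> and \<open>U\<close> independent and uniform on \<open>[0, a]\<close>. It is obtained as a limit of
  \<open>n\<close>-th powers in \<open>real_cf_exp_decrement\<close>.

  Averaging a characteristic function over a centred Gaussian gives the integral of a Gaussian
  function against the underlying law (\<open>integral_gaussian_scale\<close>). Three facts follow from this one
  identity: pointwise limits of characteristic functions that are continuous at \<open>0\<close> are
  characteristic functions (\<open>real_cf_limit\<close>); a law whose characteristic function vanishes at
  infinity, as \<open>J\<close> does, has no atom at \<open>0\<close>; and an integrable real characteristic function has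
  nonnegative integral, which is part (ii).
\<close>

section \<open>Real characteristic functions\<close>

definition real_cf :: "(real \<Rightarrow> real) \<Rightarrow> bool" where
  "real_cf f \<longleftrightarrow> (\<exists>\<mu>. real_distribution \<mu> \<and> (\<forall>z. char \<mu> z = complex_of_real (f z)))"

lemma real_cfI:
  "real_distribution \<mu> \<Longrightarrow> (\<And>z. char \<mu> z = complex_of_real (f z)) \<Longrightarrow> real_cf f"
  unfolding real_cf_def by blast

lemma (in real_distribution) char_minus: "char M (- z) = cnj (char M z)"
proof -
  have "char M (- z) = (CLINT x|M. cnj (iexp (z * x)))"
    unfolding char_def by (simp add: exp_cnj)
  also have "\<dots> = cnj (char M z)"
    unfolding char_def by simp
  finally show ?thesis .
qed

lemma real_cf_zero: "real_cf f \<Longrightarrow> f 0 = 1"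
  unfolding real_cf_def by (metis of_real_eq_1_iff real_distribution.char_zero)

lemma real_cf_even: "real_cf f \<Longrightarrow> f (- z) = f z"
  unfolding real_cf_def
  by (metis real_distribution.char_minus complex_cnj_complex_of_real of_real_eq_iff)

lemma real_cf_abs_le_1: "real_cf f \<Longrightarrow> \<bar>f z\<bar> \<le> 1"
  unfolding real_cf_def by (metis norm_of_real real_distribution.cmod_char_le_1)

lemma real_cf_isCont:
  assumes "real_cf f"
  shows "isCont f z"
proof -
  from assms obtain \<mu> where \<mu>: "real_distribution \<mu>" "\<And>z. char \<mu> z = complex_of_real (f z)"
    unfolding real_cf_def by blast
  have "isCont (\<lambda>z. Re (char \<mu> z)) z"
    by (intro continuous_Re real_distribution.isCont_char[OF \<mu>(1)])
  then show ?thesis by (simp add: \<mu>(2))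
qed

lemma real_cf_measurable: "real_cf f \<Longrightarrow> f \<in> borel_measurable borel"
  by (intro borel_measurable_continuous_onI continuous_at_imp_continuous_on ballI real_cf_isCont)

text \<open>Reflecting the law conjugates its characteristic function, and a characteristic function
  determines its law.\<close>

lemma symmetric_measure_if_real_char:
  assumes \<mu>: "real_distribution \<mu>" and f: "\<And>z. char \<mu> z = complex_of_real (f z)"
  shows "symmetric_measure \<mu>"
proof -
  interpret real_distribution \<mu> by fact
  have "char (distr \<mu> borel uminus) z = char \<mu> z" for z
  proof -
    have "char (distr \<mu> borel uminus) z = char \<mu> (- z)"
      by (simp add: char_def integral_distr)
    also have "\<dots> = char \<mu> z"
      unfolding char_minus by (simp add: f)
    finally show ?thesis .
  qed
  then have eq: "distr \<mu> borel uminus = \<mu>"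
    by (intro Levy_uniqueness ext) (auto simp: \<mu>)
  have "measure \<mu> B = measure \<mu> (uminus ` B)" if B: "B \<in> sets borel" for B
  proof -
    have "measure (distr \<mu> borel uminus) B = measure \<mu> (uminus -` B)"
      using B by (subst measure_distr) auto
    moreover have "uminus -` B = uminus ` B"
      by (force simp: image_iff)
    ultimately show ?thesis by (simp add: eq)
  qed
  then show ?thesis unfolding symmetric_measure_def by blast
qed

section \<open>Gaussian averages of characteristic functions\<close>

text \<open>Both sides are the double integral of \<open>iexp (s * z * x)\<close> against \<open>\<mu>\<close> and \<open>\<nu>\<close>.\<close>

lemma integral_char_scale_swap:
  assumes "real_distribution \<mu>" and "real_distribution \<nu>"
  shows "(CLINT z|\<nu>. char \<mu> (s * z)) = (CLINT x|\<mu>. char \<nu> (s * x))"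
proof -
  interpret \<mu>: real_distribution \<mu> by fact
  interpret \<nu>: real_distribution \<nu> by fact
  interpret P: pair_prob_space \<mu> \<nu> ..
  have int: "complex_integrable (\<mu> \<Otimes>\<^sub>M \<nu>) (\<lambda>(x, z). iexp (s * z * x))"
    by (rule P.P.integrable_const_bound[where B = 1]) (auto simp: split_beta')
  show ?thesis
    using P.Fubini_integral[OF int] unfolding char_def
    by (simp add: mult_ac)
qed

text \<open>The standard normal law has the Gaussian characteristic function \<open>exp (- (x^2) / 2)\<close>. A small
  \<open>s\<close> makes the right-hand side see how much mass \<open>\<mu>\<close> has far away, a large \<open>s\<close> makes it see the
  atom at \<open>0\<close>, and for every \<open>s\<close> it is positive.\<close>

lemma integral_gaussian_scale:
  assumes \<mu>: "real_distribution \<mu>" and f: "\<And>z. char \<mu> z = complex_of_real (f z)"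
  shows "(LINT z|std_normal_distribution. f (s * z)) = (LINT x|\<mu>. exp (- ((s * x)\<^sup>2) / 2))"
proof -
  have "complex_of_real (LINT z|std_normal_distribution. f (s * z))
      = (CLINT z|std_normal_distribution. char \<mu> (s * z))"
    by (simp add: f)
  also have "\<dots> = (CLINT x|\<mu>. complex_of_real (exp (- ((s * x)\<^sup>2) / 2)))"
    by (subst integral_char_scale_swap[OF \<mu> real_dist_normal_dist])
       (simp add: char_std_normal_distribution)
  also have "\<dots> = complex_of_real (LINT x|\<mu>. exp (- ((s * x)\<^sup>2) / 2))"
    by (rule integral_complex_of_real)
  finally show ?thesis by (simp only: of_real_eq_iff)
qed

text \<open>The Gaussian function on the right of \<open>integral_gaussian_scale\<close> equals \<open>1\<close> at \<open>0\<close>, so every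
  Gaussian average of \<open>f\<close> is at least the mass of the atom. For a wide Gaussian the average is
  small because \<open>f\<close> is even and vanishes at infinity.\<close>

lemma no_atom_at_zero_if_char_vanishes:
  assumes \<mu>: "real_distribution \<mu>" and f: "\<And>z. char \<mu> z = complex_of_real (f z)"
    and lim: "(f \<longlongrightarrow> 0) at_top"
  shows "measure \<mu> {0} = 0"
proof -
  interpret real_distribution \<mu> by fact
  interpret N: real_distribution std_normal_distribution by (rule real_dist_normal_dist)
  have cf: "real_cf f" using \<mu> f by (rule real_cfI)
  note [measurable] = real_cf_measurable[OF cf]
  have "measure \<mu> {0} \<le> (LINT z|std_normal_distribution. f (real n * z))" for n
  proof -
    have "measure \<mu> {0} = (LINT x|\<mu>. indicator {0} x)" by simp
    also have "\<dots> \<le> (LINT x|\<mu>. exp (- ((real n * x)\<^sup>2) / 2))"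
    proof (rule integral_mono)
      show "integrable \<mu> (\<lambda>x. exp (- ((real n * x)\<^sup>2) / 2))"
        by (rule integrable_const_bound[where B = 1]) auto
    qed (auto split: split_indicator simp: emeasure_eq_measure)
    finally show ?thesis unfolding integral_gaussian_scale[OF \<mu> f] .
  qed
  moreover have "(\<lambda>n. LINT z|std_normal_distribution. f (real n * z)) \<longlonglongrightarrow> (LINT z|std_normal_distribution. 0)"
  proof (rule integral_dominated_convergence[where w = "\<lambda>_. 1"])
    have pos: "(\<lambda>n. f (real n * z)) \<longlonglongrightarrow> 0" if "0 < z" for z
      by (rule filterlim_compose[OF lim])
         (rule filterlim_at_top_mult_tendsto_pos[OF tendsto_const that filterlim_real_sequentially])
    have "(\<lambda>n. f (real n * z)) \<longlonglongrightarrow> 0" if "z \<noteq> 0" for z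
      using pos[of z] pos[of "- z"] that real_cf_even[OF cf] by (cases "0 < z") auto
    moreover have "AE z in std_normal_distribution. z \<noteq> 0"
      by (subst AE_density) (auto intro!: eventually_mono[OF AE_lborel_singleton[of 0]])
    ultimately show "AE z in std_normal_distribution. (\<lambda>n. f (real n * z)) \<longlonglongrightarrow> 0"
      by (auto elim!: eventually_mono)
  qed (use real_cf_abs_le_1[OF cf] in auto)
  ultimately have "measure \<mu> {0} \<le> 0"
    by (intro LIMSEQ_le_const) auto
  then show ?thesis by (simp add: measure_le_0_iff)
qed

text \<open>The Gaussian averages of \<open>f\<close> are nonnegative. Up to a positive factor they are the integrals of
  \<open>f\<close> against increasingly flat Gaussian densities, which approach a multiple of \<open>\<integral> f\<close>.\<close>

lemma real_cf_integral_nonneg: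
  assumes cf: "real_cf f" and int: "integrable lborel f"
  shows "0 \<le> (LINT z|lborel. f z)"
proof -
  obtain \<mu> where \<mu>: "real_distribution \<mu>" and f: "\<And>z. char \<mu> z = complex_of_real (f z)"
    using cf unfolding real_cf_def by blast
  note [measurable] = real_cf_measurable[OF cf]
  let ?d = "std_normal_density"
  have nn: "0 \<le> (LINT w|lborel. ?d (1 / real (Suc n) * w) * f w)" for n
  proof -
    let ?s = "real (Suc n)"
    have "0 \<le> (LINT z|std_normal_distribution. f (?s * z))"
      unfolding integral_gaussian_scale[OF \<mu> f] by (rule Bochner_Integration.integral_nonneg) simp
    also have "\<dots> = (LINT z|lborel. ?d z * f (?s * z))"
      by (subst integral_density) auto
    also have "\<dots> = 1 / ?s * (LINT w|lborel. ?d (1 / ?s * w) * f w)"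
      by (subst lborel_integral_real_affine[where c = "1 / ?s" and t = 0]) auto
    finally show ?thesis by (simp add: zero_le_divide_iff)
  qed
  have "(\<lambda>n. LINT w|lborel. ?d (1 / real (Suc n) * w) * f w) \<longlonglongrightarrow> (LINT w|lborel. ?d 0 * f w)"
  proof (rule integral_dominated_convergence[where w = "\<lambda>w. ?d 0 * norm (f w)"])
    have "(\<lambda>n. ?d (1 / real (Suc n) * w)) \<longlonglongrightarrow> ?d 0" for w
    proof (rule isCont_tendsto_compose[of 0 ?d])
      show "isCont ?d 0" unfolding std_normal_density_def by (intro continuous_intros) auto
      show "(\<lambda>n. 1 / real (Suc n) * w) \<longlonglongrightarrow> 0"
        using tendsto_mult_right[OF LIMSEQ_inverse_real_of_nat, of w]
        by (simp add: inverse_eq_divide)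
    qed
    then show "AE w in lborel. (\<lambda>n. ?d (1 / real (Suc n) * w) * f w) \<longlonglongrightarrow> ?d 0 * f w"
      by (intro AE_I2 tendsto_intros)
    have "?d x \<le> ?d 0" for x by (simp add: std_normal_density_def divide_right_mono)
    then show "AE w in lborel. norm (?d (1 / real (Suc n) * w) * f w) \<le> ?d 0 * norm (f w)" for n
      by (intro AE_I2) (simp add: abs_mult mult_right_mono del: of_nat_Suc)
  qed (use int in auto)
  then have "0 \<le> (LINT w|lborel. ?d 0 * f w)"
    by (rule LIMSEQ_le_const) (use nn in blast)
  moreover have "0 < ?d 0" by (simp add: std_normal_density_def)
  ultimately show ?thesis by (simp add: zero_le_mult_iff)
qed

section \<open>Limits of characteristic functions\<close>

text \<open>A lower bound for the mass on a bounded interval in terms of the characteristic function alone,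
  as needed for tightness: outside of the interval the Gaussian function in
  \<open>integral_gaussian_scale\<close> is at most \<open>exp (- 1/2)\<close>.\<close>

lemma real_cf_mass_near_zero:
  assumes \<mu>: "real_distribution \<mu>" and f: "\<And>z. char \<mu> z = complex_of_real (f z)" and s: "0 < s"
  shows "1 - (1 - (LINT z|std_normal_distribution. f (s * z))) / (1 - exp (- 1 / 2))
         \<le> measure \<mu> {- 1 / s<..1 / s}"
proof -
  interpret real_distribution \<mu> by fact
  define k where "k = 1 - exp (- 1 / 2 :: real)"
  have k: "0 < k" by (simp add: k_def)
  let ?A = "{- 1 / s<..1 / s}"
  have "(LINT x|\<mu>. exp (- ((s * x)\<^sup>2) / 2)) \<le> (LINT x|\<mu>. (1 - k) + k * indicator ?A x)"
  proof (rule integral_mono)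
    show "integrable \<mu> (\<lambda>x. exp (- ((s * x)\<^sup>2) / 2))"
      by (rule integrable_const_bound[where B = 1]) auto
    show "integrable \<mu> (\<lambda>x. (1 - k) + k * indicator ?A x)"
      by (rule integrable_const_bound[where B = "\<bar>1 - k\<bar> + \<bar>k\<bar>"])
         (auto split: split_indicator)
    fix x
    show "exp (- ((s * x)\<^sup>2) / 2) \<le> (1 - k) + k * indicator ?A x"
    proof (cases "x \<in> ?A")
      case False
      then have "1 \<le> \<bar>s * x\<bar>"
        using s by (auto simp: field_simps abs_mult abs_if)
      then have "1 \<le> (s * x)\<^sup>2"
        by (metis one_le_power power2_abs)
      then show ?thesis using False by (simp add: k_def)
    qed simp
  qed
  also have "\<dots> = 1 - k + k * measure \<mu> ?A"
    using prob_space by (subst Bochner_Integration.integral_add) (auto simp: integrable_real_mult_indicator emeasure_eq_measure)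
  finally have "1 - (LINT z|std_normal_distribution. f (s * z)) \<ge> k * (1 - measure \<mu> ?A)"
    unfolding integral_gaussian_scale[OF \<mu> f] by (simp add: algebra_simps)
  then have "1 - measure \<mu> ?A \<le> (1 - (LINT z|std_normal_distribution. f (s * z))) / k"
    using k by (simp add: pos_le_divide_eq mult.commute)
  then show ?thesis by (simp add: k_def)
qed

lemma gaussian_average_tendsto_one:
  fixes f :: "real \<Rightarrow> real"
  assumes [measurable]: "f \<in> borel_measurable borel" and bd: "\<And>z. \<bar>f z\<bar> \<le> 1"
    and cont: "isCont f 0" and f0: "f 0 = 1"
  shows "(\<lambda>m. LINT z|std_normal_distribution. f (1 / real (Suc m) * z)) \<longlonglongrightarrow> 1"
proof -
  interpret N: real_distribution std_normal_distribution by (rule real_dist_normal_dist)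
  have "(\<lambda>m. LINT z|std_normal_distribution. f (1 / real (Suc m) * z))
         \<longlonglongrightarrow> (LINT z|std_normal_distribution. 1)"
  proof (rule integral_dominated_convergence[where w = "\<lambda>_. 1"])
    have "(\<lambda>m. f (1 / real (Suc m) * z)) \<longlonglongrightarrow> f 0" for z
    proof (rule isCont_tendsto_compose[OF cont])
      show "(\<lambda>m. 1 / real (Suc m) * z) \<longlonglongrightarrow> 0"
        using tendsto_mult_right[OF LIMSEQ_inverse_real_of_nat, of z]
        by (simp add: inverse_eq_divide)
    qed
    then show "AE z in std_normal_distribution. (\<lambda>m. f (1 / real (Suc m) * z)) \<longlonglongrightarrow> 1"
      by (simp add: f0)
  qed (use bd in auto)
  then show ?thesis using N.prob_space by simp
qed

text \<open>Levy's continuity theorem in the form that produces the limit law. The Gaussian averages of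
  \<open>g n\<close> converge to those of \<open>f\<close>, and the latter are close to \<open>1\<close> for a narrow Gaussian because
  \<open>f\<close> is continuous at \<open>0\<close>. By \<open>real_cf_mass_near_zero\<close> the laws are tight, and every weak limit
  along a subsequence has the characteristic function \<open>f\<close>.\<close>

lemma real_cf_limit:
  assumes cf: "\<forall>\<^sub>F n in sequentially. real_cf (g n)"
    and lim: "\<And>z. (\<lambda>n. g n z) \<longlonglongrightarrow> f z" and cont: "isCont f 0"
  shows "real_cf f"
proof -
  interpret N: real_distribution std_normal_distribution by (rule real_dist_normal_dist)
  obtain n0 where n0: "\<And>n. n \<ge> n0 \<Longrightarrow> real_cf (g n)"
    using cf unfolding eventually_sequentially by blast
  define h where "h n = g (n + n0)" for n
  have h: "real_cf (h n)" for n by (simp add: h_def n0)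
  have hlim: "(\<lambda>n. h n z) \<longlonglongrightarrow> f z" for z
    unfolding h_def using lim by (rule LIMSEQ_ignore_initial_segment)
  have "\<forall>n. \<exists>\<mu>. real_distribution \<mu> \<and> (\<forall>z. char \<mu> z = complex_of_real (h n z))"
    using h unfolding real_cf_def by blast
  then obtain \<mu> where \<mu>: "\<And>n. real_distribution (\<mu> n)"
    and ch: "\<And>n z. char (\<mu> n) z = complex_of_real (h n z)"
    by metis
  interpret \<mu>: real_distribution "\<mu> n" for n by (rule \<mu>)
  have [measurable]: "h n \<in> borel_measurable borel" for n by (rule real_cf_measurable[OF h])
  have fm [measurable]: "f \<in> borel_measurable borel"
    by (rule borel_measurable_LIMSEQ_real[OF hlim]) auto
  have f0: "f 0 = 1"
    using hlim[of 0] real_cf_zero[OF h] by (simp add: LIMSEQ_const_iff)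
  have fb: "\<bar>f z\<bar> \<le> 1" for z
    by (rule LIMSEQ_le_const2[OF tendsto_rabs[OF hlim]]) (use real_cf_abs_le_1[OF h] in auto)
  define k where "k = 1 - exp (- 1 / 2 :: real)"
  have k: "0 < k" by (simp add: k_def)
  define G where "G n m = (LINT z|std_normal_distribution. h n (1 / real (Suc m) * z))" for n m
  define H where "H m = (LINT z|std_normal_distribution. f (1 / real (Suc m) * z))" for m
  define K where "K m = {- real (Suc m)<..real (Suc m)}" for m
  have mass: "1 - (1 - G n m) / k \<le> measure (\<mu> n) (K m)" for n m
    using real_cf_mass_near_zero[OF \<mu> ch, of "1 / real (Suc m)" n]
    by (simp add: G_def K_def k_def)
  have "tight \<mu>"
    unfolding tight_def
  proof (intro conjI allI impI \<mu>)
    fix e :: real assume e: "0 < e"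
    have small: "1 - e < measure (\<mu> n) (K m)" if "1 - e * k < G n m" for n m
    proof -
      have "(1 - G n m) / k < e" using that k by (simp add: divide_less_eq)
      with mass[of n m] show ?thesis by linarith
    qed
    have lt: "1 - e * k < 1" using e k by simp
    \<comment> \<open>A single law is tight; this takes care of the finitely many indices before the uniform
      bound coming from the limit \<open>f\<close> sets in.\<close>
    have each: "\<forall>\<^sub>F m in sequentially. 1 - e < measure (\<mu> n) (K m)" for n
    proof -
      have "(\<lambda>m. G n m) \<longlonglongrightarrow> 1" unfolding G_def
        using h by (intro gaussian_average_tendsto_one real_cf_abs_le_1 real_cf_isCont real_cf_zero) auto
      from order_tendstoD(1)[OF this lt] show ?thesis
        by (rule eventually_mono) (rule small)
    qed
    have "H \<longlonglongrightarrow> 1" unfolding H_def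
      by (intro gaussian_average_tendsto_one fb cont f0) auto
    from order_tendstoD(1)[OF this lt] obtain m0 where m0: "1 - e * k < H m0"
      unfolding eventually_sequentially by auto
    have "(\<lambda>n. G n m0) \<longlonglongrightarrow> H m0" unfolding G_def H_def
      by (rule integral_dominated_convergence[where w = "\<lambda>_. 1"])
         (use hlim real_cf_abs_le_1[OF h] in auto)
    from order_tendstoD(1)[OF this m0] obtain n1 where n1: "\<And>n. n \<ge> n1 \<Longrightarrow> 1 - e * k < G n m0"
      unfolding eventually_sequentially by auto
    have "\<forall>\<^sub>F m in sequentially. \<forall>n\<in>{..<n1}. 1 - e < measure (\<mu> n) (K m)"
      using each by (intro eventually_ball_finite) auto
    then have "\<forall>\<^sub>F m in sequentially. m0 \<le> m \<and> (\<forall>n\<in>{..<n1}. 1 - e < measure (\<mu> n) (K m))"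
      using eventually_ge_at_top[of m0] by eventually_elim auto
    then obtain m where m: "m0 \<le> m" "\<And>n. n < n1 \<Longrightarrow> 1 - e < measure (\<mu> n) (K m)"
      unfolding eventually_sequentially by blast
    have "1 - e < measure (\<mu> n) (K m)" for n
    proof (cases "n < n1")
      case False
      have "1 - e < measure (\<mu> n) (K m0)" using False by (intro small n1) simp
      also have "\<dots> \<le> measure (\<mu> n) (K m)"
        using m(1) by (intro \<mu>.finite_measure_mono) (auto simp: K_def)
      finally show ?thesis .
    qed (use m in simp)
    then show "\<exists>a b. a < b \<and> (\<forall>n. 1 - e < measure (\<mu> n) {a<..b})"
      unfolding K_def by (intro exI[of _ "- real (Suc m)"] exI[of _ "real (Suc m)"]) auto
  qed
  from tight_imp_convergent_subsubsequence[OF this strict_mono_id]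
  obtain r \<nu> where r: "strict_mono (r :: nat \<Rightarrow> nat)" and \<nu>: "real_distribution \<nu>"
    and conv: "weak_conv_m (\<mu> \<circ> id \<circ> r) \<nu>" by blast
  show ?thesis
  proof (rule real_cfI[OF \<nu>])
    fix z
    have "(\<lambda>n. char ((\<mu> \<circ> id \<circ> r) n) z) \<longlonglongrightarrow> char \<nu> z"
      by (rule levy_continuity1[OF _ \<nu> conv]) (simp add: \<mu>)
    moreover have "(\<lambda>n. char ((\<mu> \<circ> id \<circ> r) n) z) \<longlonglongrightarrow> complex_of_real (f z)"
      using LIMSEQ_subseq_LIMSEQ[OF hlim[of z] r]
      by (simp add: ch comp_def tendsto_of_real)
    ultimately show "char \<nu> z = complex_of_real (f z)" by (rule LIMSEQ_unique)
  qed
qed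

section \<open>Operations on characteristic functions\<close>

text \<open>This is the characteristic function of the law reweighted by the density
  \<open>(1 - cos (T * x)) / (1 - f T)\<close>. Multiplication by \<open>cos (T * x)\<close> averages the shifts of the
  characteristic function by \<open>T\<close> and \<open>- T\<close>, which also shows that \<open>1 - f T\<close> is the right
  normalization. The weight vanishes at \<open>x = 0\<close> and so suppresses mass that concentrates there.\<close>

lemma real_cf_tilt:
  assumes "real_cf f" and T: "f T < 1"
  shows "real_cf (\<lambda>z. (f z - (f (z + T) + f (z - T)) / 2) / (1 - f T))"
proof -
  obtain \<mu> where \<mu>: "real_distribution \<mu>" and f: "\<And>z. char \<mu> z = complex_of_real (f z)"
    using assms(1) unfolding real_cf_def by blast
  interpret real_distribution \<mu> by fact
  let ?w = "\<lambda>x. (1 - cos (T * x)) / (1 - f T)"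
  have w0: "0 \<le> ?w x" for x using T by simp
  have ii: "complex_integrable \<mu> (\<lambda>x. iexp (z * x))" for z
    by (rule integrable_iexp) auto
  have ic: "integrable \<mu> (\<lambda>x. cos (T * x))"
    by (rule integrable_const_bound[where B = 1]) auto
  have "(LINT x|\<mu>. cos (T * x)) = Re (char \<mu> T)"
    unfolding char_def using ii[of T] by (simp add: cos_of_real flip: integral_Re add: Re_exp)
  then have cosT: "(LINT x|\<mu>. cos (T * x)) = f T" by (simp add: f)
  have wint: "integrable \<mu> ?w" using ic by auto
  have "(LINT x|\<mu>. ?w x) = 1"
    using ic T prob_space by (simp add: cosT)
  then have "emeasure (density \<mu> ?w) (space (density \<mu> ?w)) = 1"
    using wint w0 by (simp add: emeasure_density nn_integral_eq_integral)
  then have d: "real_distribution (density \<mu> ?w)"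
    by (auto simp: real_distribution_def real_distribution_axioms_def intro: prob_spaceI)
  show ?thesis
  proof (rule real_cfI[OF d])
    fix z
    have pt: "?w x *\<^sub>R iexp (z * x)
      = (iexp (z * x) - (iexp ((z + T) * x) + iexp ((z - T) * x)) / 2) / complex_of_real (1 - f T)" for x
    proof -
      have "complex_of_real (cos (T * x)) * iexp (z * x) = (iexp ((z + T) * x) + iexp ((z - T) * x)) / 2"
        by (simp add: cos_exp_eq ring_distribs exp_add exp_diff exp_minus field_simps flip: cos_of_real)
      moreover have "?w x *\<^sub>R iexp (z * x)
        = (iexp (z * x) - complex_of_real (cos (T * x)) * iexp (z * x)) / complex_of_real (1 - f T)"
        by (simp add: scaleR_conv_of_real left_diff_distrib del: of_real_mult)
      ultimately show ?thesis by simp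
    qed
    have "char (density \<mu> ?w) z = (CLINT x|\<mu>. ?w x *\<^sub>R iexp (z * x))"
      unfolding char_def using w0 by (subst integral_density) auto
    also have "\<dots> = (char \<mu> z - (char \<mu> (z + T) + char \<mu> (z - T)) / 2) / complex_of_real (1 - f T)"
      unfolding pt char_def using ii[of z] ii[of "z + T"] ii[of "z - T"]
      by (simp del: of_real_mult of_real_add of_real_diff)
    also have "\<dots> = complex_of_real ((f z - (f (z + T) + f (z - T)) / 2) / (1 - f T))"
      by (simp add: f)
    finally show "char (density \<mu> ?w) z = \<dots>" .
  qed
qed

text \<open>Two given laws are realized by independent variables on the plane.\<close>

lemma projections_independent:
  fixes \<mu> \<nu> :: "real measure"
  assumes "real_distribution \<mu>" and "real_distribution \<nu>"
  shows "prob_space (\<mu> \<Otimes>\<^sub>M \<nu>)"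
    and "prob_space.indep_var (\<mu> \<Otimes>\<^sub>M \<nu>) borel fst borel snd"
    and "distr (\<mu> \<Otimes>\<^sub>M \<nu>) borel fst = \<mu>" and "distr (\<mu> \<Otimes>\<^sub>M \<nu>) borel snd = \<nu>"
proof -
  interpret \<mu>: real_distribution \<mu> by fact
  interpret \<nu>: real_distribution \<nu> by fact
  interpret P: pair_prob_space \<mu> \<nu> ..
  show "prob_space (\<mu> \<Otimes>\<^sub>M \<nu>)" by (rule P.P.prob_space_axioms)
  have "distr (\<mu> \<Otimes>\<^sub>M \<nu>) borel fst = distr (\<mu> \<Otimes>\<^sub>M \<nu>) \<mu> fst" by (rule distr_cong) auto
  also have "\<dots> = \<mu>" by (rule \<nu>.distr_pair_fst)
  finally show 1: "distr (\<mu> \<Otimes>\<^sub>M \<nu>) borel fst = \<mu>" .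
  show 2: "distr (\<mu> \<Otimes>\<^sub>M \<nu>) borel snd = \<nu>"
  proof (rule measure_eqI)
    fix A assume "A \<in> sets (distr (\<mu> \<Otimes>\<^sub>M \<nu>) borel snd)"
    then have A: "A \<in> sets borel" by simp
    have "emeasure (distr (\<mu> \<Otimes>\<^sub>M \<nu>) borel snd) A = emeasure (\<mu> \<Otimes>\<^sub>M \<nu>) (UNIV \<times> A)"
      using A by (subst emeasure_distr) (auto simp: space_pair_measure intro!: arg_cong[where f = "emeasure _"])
    also have "\<dots> = emeasure \<nu> A"
      using A \<mu>.emeasure_space_1 by (subst \<nu>.emeasure_pair_measure_Times) auto
    finally show "emeasure (distr (\<mu> \<Otimes>\<^sub>M \<nu>) borel snd) A = emeasure \<nu> A" .
  qed simp
  have "distr (\<mu> \<Otimes>\<^sub>M \<nu>) (borel \<Otimes>\<^sub>M borel) (\<lambda>x. (fst x, snd x)) = distr (\<mu> \<Otimes>\<^sub>M \<nu>) (\<mu> \<Otimes>\<^sub>M \<nu>) (\<lambda>x. x)"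
    by (rule distr_cong) (auto intro: sets_pair_measure_cong)
  then show "P.indep_var borel fst borel snd"
    unfolding P.indep_var_distribution_eq 1 2 by (auto simp: distr_id)
qed

lemma char_distr_scale:
  assumes [measurable]: "X \<in> borel_measurable M"
  shows "char (distr M borel (\<lambda>\<omega>. c * X \<omega>)) z = char (distr M borel X) (c * z)"
  by (simp add: char_def integral_distr mult_ac)

lemma char_scaled_sum:
  assumes "prob_space N" and ind: "prob_space.indep_var N borel X borel Y"
  shows "char (distr N borel (\<lambda>\<omega>. c * X \<omega> + Y \<omega>)) z
         = char (distr N borel X) (c * z) * char (distr N borel Y) z"
proof -
  interpret prob_space N by fact
  have [measurable]: "X \<in> borel_measurable N" using ind by (rule indep_var_rv1)
  have "indep_var borel ((\<lambda>x. c * x) \<circ> X) borel ((\<lambda>x. x) \<circ> Y)"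
    by (rule indep_var_compose[OF ind]) auto
  then show ?thesis
    by (subst char_distr_add) (auto simp: comp_def char_distr_scale)
qed

lemma real_cf_mult:
  assumes "real_cf f" and "real_cf g"
  shows "real_cf (\<lambda>z. f z * g z)"
proof -
  obtain \<mu> where \<mu>: "real_distribution \<mu>" "\<And>z. char \<mu> z = complex_of_real (f z)"
    using assms(1) unfolding real_cf_def by blast
  obtain \<nu> where \<nu>: "real_distribution \<nu>" "\<And>z. char \<nu> z = complex_of_real (g z)"
    using assms(2) unfolding real_cf_def by blast
  note pr = projections_independent[OF \<mu>(1) \<nu>(1)]
  interpret P: prob_space "\<mu> \<Otimes>\<^sub>M \<nu>" by (rule pr(1))
  show ?thesis
  proof (rule real_cfI)
    show "real_distribution (distr (\<mu> \<Otimes>\<^sub>M \<nu>) borel (\<lambda>\<omega>. 1 * fst \<omega> + snd \<omega>))"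
      using P.indep_var_rv1[OF pr(2)] P.indep_var_rv2[OF pr(2)] by simp
    show "char (distr (\<mu> \<Otimes>\<^sub>M \<nu>) borel (\<lambda>\<omega>. 1 * fst \<omega> + snd \<omega>)) z = complex_of_real (f z * g z)" for z
      unfolding char_scaled_sum[OF pr(1,2)] pr(3,4) by (simp add: \<mu> \<nu>)
  qed
qed

lemma real_cf_one: "real_cf (\<lambda>z. 1)"
proof (rule real_cfI)
  show "real_distribution (return borel 0)"
    by (auto simp: real_distribution_def real_distribution_axioms_def prob_space_return)
  show "char (return borel 0) z = complex_of_real 1" for z
    unfolding char_def by (subst integral_return) auto
qed

lemma real_cf_power: "real_cf f \<Longrightarrow> real_cf (\<lambda>z. f z ^ n)"
  by (induction n) (auto intro: real_cf_one real_cf_mult)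

text \<open>The law of \<open>r U * Y\<close> for independent \<open>U\<close> and \<open>Y\<close>.\<close>

lemma real_cf_scale_mixture:
  assumes "prob_space P" and r [measurable]: "r \<in> borel_measurable P" and "real_cf f"
  shows "real_cf (\<lambda>z. LINT u|P. f (r u * z))"
proof -
  obtain \<mu> where \<mu>: "real_distribution \<mu>" "\<And>z. char \<mu> z = complex_of_real (f z)"
    using assms(3) unfolding real_cf_def by blast
  interpret P: prob_space P by fact
  interpret \<mu>: real_distribution \<mu> by fact
  interpret PM: pair_prob_space P \<mu> ..
  have [measurable]: "(\<lambda>(u, y). r u * y) \<in> borel_measurable (P \<Otimes>\<^sub>M \<mu>)" by measurable
  show ?thesis
  proof (rule real_cfI)
    show "real_distribution (distr (P \<Otimes>\<^sub>M \<mu>) borel (\<lambda>(u, y). r u * y))" by simp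
    fix z
    have int: "complex_integrable (P \<Otimes>\<^sub>M \<mu>) (\<lambda>(u, y). iexp (z * (r u * y)))"
      by (rule PM.P.integrable_const_bound[where B = 1]) (auto simp: split_beta')
    have "char (distr (P \<Otimes>\<^sub>M \<mu>) borel (\<lambda>(u, y). r u * y)) z
        = (CLINT x|P \<Otimes>\<^sub>M \<mu>. (\<lambda>(u, y). iexp (z * (r u * y))) x)"
      by (simp add: char_def integral_distr split_beta')
    also have "\<dots> = (CLINT u|P. char \<mu> (r u * z))"
      using PM.integral_fst'[OF int] by (simp add: char_def mult_ac)
    also have "\<dots> = complex_of_real (LINT u|P. f (r u * z))"
      by (simp add: \<mu>)
    finally show "char (distr (P \<Otimes>\<^sub>M \<mu>) borel (\<lambda>(u, y). r u * y)) z = \<dots>" .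
  qed
qed

section \<open>Self-decomposability and the logarithmic derivative\<close>

text \<open>The characteristic function of the remainder must be the quotient, since that of an
  independent sum is the product. If the quotient is a characteristic function, a remainder
  with the right joint law exists on the plane, and uniqueness of characteristic functions gives
  the equality in law.\<close>

lemma self_decomposable_iff_quotients:
  assumes "prob_space M" and X [measurable]: "X \<in> borel_measurable M"
    and \<phi>: "\<And>z. char (distr M borel X) z = complex_of_real (\<phi> z)" and nz: "\<And>z. \<phi> z \<noteq> 0"
  shows "self_decomposable M X \<longleftrightarrow> (\<forall>c\<in>{0<..<1}. real_cf (\<lambda>z. \<phi> z / \<phi> (c * z)))"
proof
  assume sd: "self_decomposable M X"
  show "\<forall>c\<in>{0<..<1}. real_cf (\<lambda>z. \<phi> z / \<phi> (c * z))"
  proof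
    fix c :: real assume "c \<in> {0<..<1}"
    then obtain N :: "(real \<times> real) measure" and X' Xc where N: "prob_space N"
      and Xc: "Xc \<in> borel_measurable N" and ind: "prob_space.indep_var N borel X' borel Xc"
      and eq: "distr N borel X' = distr M borel X"
      and eq2: "distr M borel X = distr N borel (\<lambda>\<omega>. c * X' \<omega> + Xc \<omega>)"
      using sd unfolding self_decomposable_def by meson
    show "real_cf (\<lambda>z. \<phi> z / \<phi> (c * z))"
    proof (rule real_cfI)
      show "real_distribution (distr N borel Xc)"
        using N Xc by (rule prob_space.real_distribution_distr)
      fix z
      have "char (distr M borel X) z = char (distr M borel X) (c * z) * char (distr N borel Xc) z"
        using char_scaled_sum[OF N ind, of c z] unfolding eq eq2[symmetric] .
      then show "char (distr N borel Xc) z = complex_of_real (\<phi> z / \<phi> (c * z))"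
        using nz[of "c * z"] by (simp add: \<phi> field_simps)
    qed
  qed
next
  assume cf: "\<forall>c\<in>{0<..<1}. real_cf (\<lambda>z. \<phi> z / \<phi> (c * z))"
  have D: "real_distribution (distr M borel X)"
    by (rule prob_space.real_distribution_distr[OF assms(1)]) measurable
  show "self_decomposable M X"
    unfolding self_decomposable_def
  proof
    fix c :: real assume "c \<in> {0<..<1}"
    with cf obtain \<nu> where \<nu>: "real_distribution \<nu>"
      and ch: "\<And>z. char \<nu> z = complex_of_real (\<phi> z / \<phi> (c * z))"
      unfolding real_cf_def by blast
    define N where "N = distr M borel X \<Otimes>\<^sub>M \<nu>"
    note pr = projections_independent[OF D \<nu>, folded N_def]
    interpret N: prob_space N by (rule pr(1))
    have [measurable]: "fst \<in> borel_measurable N" "snd \<in> borel_measurable N"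
      using N.indep_var_rv1[OF pr(2)] N.indep_var_rv2[OF pr(2)] by simp_all
    have "distr M borel X = distr N borel (\<lambda>\<omega>. c * fst \<omega> + snd \<omega>)"
    proof (rule Levy_uniqueness[OF D])
      show "real_distribution (distr N borel (\<lambda>\<omega>. c * fst \<omega> + snd \<omega>))" by simp
      show "char (distr M borel X) = char (distr N borel (\<lambda>\<omega>. c * fst \<omega> + snd \<omega>))"
      proof
        fix z
        have "char (distr N borel (\<lambda>\<omega>. c * fst \<omega> + snd \<omega>)) z
            = char (distr M borel X) (c * z) * char \<nu> z"
          unfolding char_scaled_sum[OF pr(1,2)] pr(3,4) ..
        then show "char (distr M borel X) z = char (distr N borel (\<lambda>\<omega>. c * fst \<omega> + snd \<omega>)) z"
          using nz[of "c * z"] by (simp add: \<phi> ch)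
      qed
    qed
    then show "\<exists>(N :: (real \<times> real) measure) X' Xc.
       prob_space N \<and> X' \<in> borel_measurable N \<and> Xc \<in> borel_measurable N \<and>
       prob_space.indep_var N borel X' borel Xc \<and>
       distr N borel X' = distr M borel X \<and>
       distr M borel X = distr N borel (\<lambda>\<omega>. c * X' \<omega> + Xc \<omega>)"
      using pr by (intro exI[of _ N] exI[of _ fst] exI[of _ snd]) auto
  qed
qed

text \<open>The target \<open>exp (- D)\<close> with \<open>D = \<Psi> z - \<Psi> (c * z)\<close> is the limit of \<open>(1 - D / n) ^ n\<close>, so it
  suffices that \<open>1 - D / n\<close> is a characteristic function for large \<open>n\<close>. Since
  \<open>D = L * \<integral>\<^sub>0\<^sup>a (1 - J (exp (- u) * z)) du\<close>, it is the average of \<open>J (r u * z)\<close> over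
  \<open>u\<close> uniform in \<open>[0, n / L]\<close>, where \<open>r u = exp (- u)\<close> up to \<open>a\<close> and \<open>r u = 0\<close> afterwards:
  the scale \<open>0\<close> contributes \<open>J 0 = 1\<close>.\<close>

lemma real_cf_exp_decrement:
  fixes \<Psi> J :: "real \<Rightarrow> real"
  assumes J: "real_cf J" and L: "0 < L"
    and deriv: "\<And>z. z \<noteq> 0 \<Longrightarrow> (\<Psi> has_real_derivative L * (1 - J z) / z) (at z)"
    and cont: "isCont \<Psi> 0" and c: "0 < c" "c < 1"
  shows "real_cf (\<lambda>z. exp (\<Psi> (c * z) - \<Psi> z))"
proof -
  define a where "a = - ln c"
  have a: "0 < a" "exp (- a) = c" using c by (simp_all add: a_def)
  have [measurable]: "J \<in> borel_measurable borel" by (rule real_cf_measurable[OF J])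
  have J0: "J 0 = 1" by (rule real_cf_zero[OF J])
  have Jc: "isCont J z" for z by (rule real_cf_isCont[OF J])
  have FTC: "has_bochner_integral lborel (\<lambda>u. L * (1 - J (exp (- u) * z)) * indicator {0..a} u)
      (\<Psi> z - \<Psi> (c * z))" for z
  proof (cases "z = 0")
    case True
    then show ?thesis by (simp add: J0 has_bochner_integral_zero)
  next
    case False
    have "has_bochner_integral lborel (\<lambda>u. L * (1 - J (exp (- u) * z)) * indicator {0..a} u)
      (- \<Psi> (exp (- a) * z) - - \<Psi> (exp (- 0) * z))"
    proof (rule has_bochner_integral_FTC_Icc_real)
      fix u :: real
      have "((\<lambda>u. - \<Psi> (exp (- u) * z)) has_real_derivative
          - (L * (1 - J (exp (- u) * z)) / (exp (- u) * z) * (- exp (- u) * z))) (at u)"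
        using False by (auto intro!: derivative_eq_intros DERIV_chain2[OF deriv])
      moreover have "- (L * A / (exp (- u) * z) * (- exp (- u) * z)) = L * A" for A
        using False by simp
      ultimately show "((\<lambda>u. - \<Psi> (exp (- u) * z)) has_real_derivative L * (1 - J (exp (- u) * z))) (at u)"
        by (simp only:)
      show "isCont (\<lambda>u. L * (1 - J (exp (- u) * z))) u"
        by (intro continuous_intros isCont_o2[OF _ Jc])
    qed (use a in simp)
    then show ?thesis by (simp add: a)
  qed
  have base: "real_cf (\<lambda>z. 1 + (\<Psi> (c * z) - \<Psi> z) / real n)" if n: "max 1 (a * L) \<le> real n" for n
  proof -
    define b where "b = real n / L"
    have b: "0 < b" "a \<le> b" "b * L = real n" using n L by (auto simp: b_def field_simps)
    define P where "P = density lborel (\<lambda>u. ennreal (indicator {0..b} u / b))"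
    define r where "r u = exp (- u) * indicator {0..a} u" for u :: real
    have [measurable]: "r \<in> borel_measurable borel" unfolding r_def by measurable
    have unif: "has_bochner_integral lborel (\<lambda>u. indicator {0..b} u / b) (1 :: real)"
      using b by (simp add: has_bochner_integral_iff)
    have "emeasure P (space P) = (\<integral>\<^sup>+u. ennreal (indicator {0..b} u / b) \<partial>lborel)"
      unfolding P_def by (subst emeasure_density) auto
    also have "\<dots> = 1"
      using unif b by (subst nn_integral_eq_integral) (auto simp: has_bochner_integral_iff)
    finally have P: "prob_space P" by (rule prob_spaceI)
    have "(LINT u|P. J (r u * z)) = 1 + (\<Psi> (c * z) - \<Psi> z) / real n" for z
    proof -
      have "(LINT u|P. J (r u * z)) = (LINT u|lborel. indicator {0..b} u / b * J (r u * z))"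
        unfolding P_def using b by (subst integral_density) auto
      also have "\<dots> = (LINT u|lborel. indicator {0..b} u / b
          - L * (1 - J (exp (- u) * z)) * indicator {0..a} u / real n)"
        using b L by (intro Bochner_Integration.integral_cong)
          (auto simp: r_def J0 b(3)[symmetric] field_simps split: split_indicator)
      also have "\<dots> = 1 - (\<Psi> z - \<Psi> (c * z)) / real n"
        by (intro has_bochner_integral_integral_eq has_bochner_integral_diff unif
            has_bochner_integral_divide_zero FTC)
      finally show ?thesis by (simp add: diff_divide_distrib)
    qed
    moreover have "real_cf (\<lambda>z. LINT u|P. J (r u * z))"
      by (rule real_cf_scale_mixture[OF P _ J]) (simp add: P_def)
    ultimately show ?thesis by simp
  qed
  show ?thesis
  proof (rule real_cf_limit)
    have "\<forall>\<^sub>F n in sequentially. max 1 (a * L) \<le> real n"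
      using filterlim_real_sequentially unfolding filterlim_at_top by blast
    then show "\<forall>\<^sub>F n in sequentially. real_cf (\<lambda>z. (1 + (\<Psi> (c * z) - \<Psi> z) / real n) ^ n)"
      by eventually_elim (intro real_cf_power base)
    show "(\<lambda>n. (1 + (\<Psi> (c * z) - \<Psi> z) / real n) ^ n) \<longlonglongrightarrow> exp (\<Psi> (c * z) - \<Psi> z)" for z
      by (rule tendsto_exp_limit_sequentially)
    show "isCont (\<lambda>z. exp (\<Psi> (c * z) - \<Psi> z)) 0"
      by (intro continuous_intros isCont_o2[of 0 "\<lambda>z. c * z" \<Psi>]) (use cont in auto)
  qed
qed

text \<open>With \<open>h c\<close> the quotient at \<open>c\<close>, the difference quotients \<open>(1 - h c z) / (1 - c)\<close> converge to
  \<open>\<psi> z\<close> for \<open>c \<rightarrow> 1\<close>. The functions given by \<open>real_cf_tilt\<close> depend on \<open>h c\<close> only through ratios of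
  such difference quotients and so have a limit \<open>g T\<close>, and \<open>g T\<close> tends to \<open>1 - \<psi> / L\<close> for
  \<open>T \<rightarrow> \<infinity>\<close>. Continuity of \<open>\<psi>\<close> lets \<open>real_cf_limit\<close> apply to both limits.\<close>

lemma real_cf_log_derivative:
  fixes \<Psi> \<psi> :: "real \<Rightarrow> real"
  assumes cf: "\<And>c. 0 < c \<Longrightarrow> c < 1 \<Longrightarrow> real_cf (\<lambda>z. exp (\<Psi> (c * z) - \<Psi> z))"
    and deriv: "\<And>z. z \<noteq> 0 \<Longrightarrow> (\<Psi> has_real_derivative \<psi> z / z) (at z)"
    and \<psi>0: "\<psi> 0 = 0" and even: "\<And>z. \<psi> (- z) = \<psi> z" and cont: "\<And>z. isCont \<psi> z"
    and lim: "(\<psi> \<longlongrightarrow> L) at_top" and L: "0 < L"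
  shows "real_cf (\<lambda>z. 1 - \<psi> z / L)"
proof -
  \<comment> \<open>The shift by \<open>2\<close> keeps \<open>c n\<close> strictly between \<open>0\<close> and \<open>1\<close> for all \<open>n\<close>.\<close>
  define c where "c n = 1 - 1 / real (n + 2)" for n :: nat
  have c: "0 < c n" "c n < 1" for n by (simp_all add: c_def field_simps)
  define h where "h n z = exp (\<Psi> (c n * z) - \<Psi> z)" for n z
  define q where "q n z = (1 - h n z) / (1 - c n)" for n z
  have h: "real_cf (h n)" for n unfolding h_def by (intro cf c)
  have clim: "filterlim c (at 1) sequentially"
    unfolding filterlim_at
  proof
    show "\<forall>\<^sub>F n in sequentially. c n \<in> UNIV \<and> c n \<noteq> 1" using c(2) by (simp add: less_imp_neq)
    have "(\<lambda>n. 1 - 1 / real (n + 2)) \<longlonglongrightarrow> 1 - 0"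
      by (intro tendsto_intros LIMSEQ_ignore_initial_segment[where f = "\<lambda>n. 1 / real n"] lim_1_over_n)
    then show "c \<longlonglongrightarrow> 1" by (simp add: c_def[abs_def])
  qed
  have q: "(\<lambda>n. q n z) \<longlonglongrightarrow> \<psi> z" for z
  proof -
    have "((\<lambda>s. exp (\<Psi> (s * z) - \<Psi> z)) has_real_derivative \<psi> z) (at 1)"
    proof (cases "z = 0")
      case False
      then have "((\<lambda>s. exp (\<Psi> (s * z) - \<Psi> z)) has_real_derivative
          exp (\<Psi> (1 * z) - \<Psi> z) * (\<psi> (1 * z) / (1 * z) * z - 0)) (at 1)"
        by (intro derivative_intros DERIV_fun_exp DERIV_diff DERIV_chain2[OF deriv])
           (auto intro!: derivative_eq_intros)
      then show ?thesis using False by simp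
    qed (simp add: \<psi>0)
    then have "((\<lambda>s. (exp (\<Psi> (s * z) - \<Psi> z) - 1) / (s - 1)) \<longlongrightarrow> \<psi> z) (at 1)"
      by (simp add: has_field_derivative_iff)
    from filterlim_compose[OF this clim]
    have "(\<lambda>n. (h n z - 1) / (c n - 1)) \<longlonglongrightarrow> \<psi> z" by (simp add: h_def)
    moreover have "(h n z - 1) / (c n - 1) = q n z" for n
      unfolding q_def by (metis minus_diff_eq minus_divide_divide)
    ultimately show ?thesis by simp
  qed
  define g where "g T z = ((\<psi> (z + T) + \<psi> (z - T)) / 2 - \<psi> z) / \<psi> T" for T z
  have tilt: "real_cf (g T)" if T: "0 < \<psi> T" for T
  proof (rule real_cf_limit)
    let ?f = "\<lambda>n z. (h n z - (h n (z + T) + h n (z - T)) / 2) / (1 - h n T)"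
    have "\<forall>\<^sub>F n in sequentially. 0 < q n T" by (rule order_tendstoD(1)[OF q T])
    then show "\<forall>\<^sub>F n in sequentially. real_cf (?f n)"
    proof eventually_elim
      case (elim n)
      then have "h n T < 1" using c(2)[of n] by (simp add: q_def zero_less_divide_iff)
      then show ?case by (rule real_cf_tilt[OF h])
    qed
    fix z
    have "((q n (z + T) + q n (z - T)) / 2 - q n z) / q n T = ?f n z" for n
    proof -
      have d: "1 - c n \<noteq> 0" using c(2)[of n] by simp
      have "((1 - x) / e + (1 - y) / e) / 2 - (1 - w) / e = (w - (x + y) / 2) / e" for x y w e :: real
        by (cases "e = 0") (simp_all add: field_simps)
      then have "(q n (z + T) + q n (z - T)) / 2 - q n z
          = (h n z - (h n (z + T) + h n (z - T)) / 2) / (1 - c n)"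
        unfolding q_def .
      then show ?thesis unfolding q_def[of n T] using d by simp
    qed
    moreover have "(\<lambda>n. ((q n (z + T) + q n (z - T)) / 2 - q n z) / q n T) \<longlonglongrightarrow> g T z"
      unfolding g_def by (intro tendsto_intros q) (use T in auto)
    ultimately show "(\<lambda>n. ?f n z) \<longlonglongrightarrow> g T z" by simp
    show "isCont (g T) 0"
      unfolding g_def by (intro continuous_intros isCont_o2[OF _ cont]) (use T in auto)
  qed
  show ?thesis
  proof (rule real_cf_limit)
    have top: "filterlim (\<lambda>n. real n + z) at_top sequentially" for z
      using filterlim_tendsto_add_at_top[OF tendsto_const[of z] filterlim_real_sequentially]
      by (simp add: add.commute)
    have lim': "(\<lambda>n. \<psi> (real n + z)) \<longlonglongrightarrow> L" for z
      by (rule filterlim_compose[OF lim top])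
    have "\<forall>\<^sub>F n in sequentially. 0 < \<psi> (real n)"
      using order_tendstoD(1)[OF lim'[of 0] L] by simp
    then show "\<forall>\<^sub>F n in sequentially. real_cf (g (real n))"
      by eventually_elim (rule tilt)
    fix z
    have "\<psi> (z - real n) = \<psi> (real n + - z)" for n
      using even[of "z - real n"] by simp
    moreover have "(\<lambda>n. ((\<psi> (real n + z) + \<psi> (real n + - z)) / 2 - \<psi> z) / \<psi> (real n + 0))
        \<longlonglongrightarrow> ((L + L) / 2 - \<psi> z) / L"
      by (intro tendsto_intros lim') (use L in auto)
    ultimately show "(\<lambda>n. g (real n) z) \<longlonglongrightarrow> 1 - \<psi> z / L"
      using L unfolding g_def by (simp add: add.commute diff_divide_distrib)
    show "isCont (\<lambda>z. 1 - \<psi> z / L) 0"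
      by (intro continuous_intros cont) (use L in auto)
  qed
qed

theorem theorem1p3:
  fixes M :: "'a measure" and X :: "'a \<Rightarrow> real"
    and \<phi> \<Psi> J :: "real \<Rightarrow> real" and L :: real
  assumes "prob_space M" and "X \<in> borel_measurable M"
    and "symmetric_rv M X"
    and "\<And>z. char (distr M borel X) z = complex_of_real (\<phi> z)"
    and "\<And>z. 0 < \<phi> z"
    and "\<Psi> = (\<lambda>z. - ln (\<phi> z))"
    and "\<Psi> C1_differentiable_on (- {0})"
    and "((\<lambda>z. z * deriv \<Psi> z) \<longlongrightarrow> 0) (at 0)"
    and "((\<lambda>z. z * deriv \<Psi> z) \<longlongrightarrow> L) at_top"
    and "0 < L"
    and "J = J_fun \<Psi> L"
  shows "(self_decomposable M X \<longleftrightarrow>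
           (\<exists>\<mu>. real_distribution \<mu> \<and> symmetric_measure \<mu> \<and> measure \<mu> {0} = 0 \<and>
                (\<forall>z. char \<mu> z = complex_of_real (J z)))) \<and>
         (self_decomposable M X \<and> integrable lborel J \<longrightarrow> 0 \<le> (LINT z|lborel. J z))"
proof -
  note X = assms(1,2) and \<phi> = assms(4) and pos = assms(5) and \<Psi> = assms(6)
    and at0 = assms(8) and attop = assms(9) and L = assms(10)
  define \<psi> where "\<psi> z = z * deriv \<Psi> z" for z
  have J: "J z = 1 - \<psi> z / L" for z
    by (simp add: assms(11) J_fun_def \<psi>_def)
  have cf\<phi>: "real_cf \<phi>"
    using prob_space.real_distribution_distr[OF X] \<phi> by (rule real_cfI)
  have ev\<Psi>: "\<Psi> (- z) = \<Psi> z" for z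
    by (simp add: \<Psi> real_cf_even[OF cf\<phi>])
  have cont\<Psi>: "isCont \<Psi> 0"
    unfolding \<Psi> using pos[of 0] by (intro continuous_intros real_cf_isCont[OF cf\<phi>]) simp
  obtain D where D: "\<And>z. z \<noteq> 0 \<Longrightarrow> (\<Psi> has_real_derivative D z) (at z)"
    and contD: "continuous_on (- {0}) D"
    using assms(7) unfolding C1_differentiable_on_def
    by (auto simp: has_real_derivative_iff_has_vector_derivative)
  have DD: "deriv \<Psi> z = D z" if "z \<noteq> 0" for z
    using D[OF that] by (rule DERIV_imp_deriv)
  have deriv: "(\<Psi> has_real_derivative \<psi> z / z) (at z)" if "z \<noteq> 0" for z
    using D[OF that] that by (simp add: \<psi>_def DD)
  have \<psi>0: "\<psi> 0 = 0" by (simp add: \<psi>_def)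
  have even: "\<psi> (- z) = \<psi> z" for z
  proof (cases "z = 0")
    case False
    have "((\<lambda>x. \<Psi> (- x)) has_real_derivative \<psi> (- z) / (- z) * (- 1)) (at z)"
      by (rule DERIV_chain2[OF deriv]) (use False in \<open>auto intro!: derivative_eq_intros\<close>)
    then have "(\<Psi> has_real_derivative \<psi> (- z) / z) (at z)" by (simp add: ev\<Psi>)
    from DERIV_unique[OF this deriv[OF False]] False show ?thesis by simp
  qed simp
  have cont: "isCont \<psi> z" for z
  proof (cases "z = 0")
    case True
    then show ?thesis using at0 by (simp add: isCont_def \<psi>_def[abs_def])
  next
    case False
    have "continuous_on (- {0}) \<psi>"
      using contD by (subst continuous_on_cong[OF refl, where g = "\<lambda>z. z * D z"])
        (auto simp: \<psi>_def DD intro!: continuous_intros)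
    then show ?thesis
      using False by (simp add: continuous_on_eq_continuous_at open_Compl)
  qed
  have lim: "(\<psi> \<longlongrightarrow> L) at_top" using attop by (simp add: \<psi>_def[abs_def])
  have quot: "\<phi> z / \<phi> (c * z) = exp (\<Psi> (c * z) - \<Psi> z)" for c z
    using pos[of z] pos[of "c * z"] by (simp add: \<Psi> exp_diff exp_minus exp_ln field_simps)
  have sd: "self_decomposable M X \<longleftrightarrow> (\<forall>c\<in>{0<..<1}. real_cf (\<lambda>z. exp (\<Psi> (c * z) - \<Psi> z)))"
    using self_decomposable_iff_quotients[OF X \<phi>] pos by (simp add: quot less_imp_neq[symmetric])
  have main: "self_decomposable M X \<longleftrightarrow> real_cf J"
  proof
    assume "self_decomposable M X"
    then have "real_cf (\<lambda>z. 1 - \<psi> z / L)"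
      using real_cf_log_derivative[OF _ deriv \<psi>0 even cont lim L] unfolding sd by simp
    then show "real_cf J" by (simp add: J[abs_def, symmetric])
  next
    assume "real_cf J"
    then show "self_decomposable M X"
      unfolding sd using L deriv cont\<Psi> by (auto intro!: real_cf_exp_decrement simp: J)
  qed
  have "(J \<longlongrightarrow> 1 - L / L) at_top"
    unfolding J[abs_def] using L by (intro tendsto_intros lim) simp
  then have J_at_top: "(J \<longlongrightarrow> 0) at_top" using L by simp
  have "real_cf J \<longleftrightarrow> (\<exists>\<mu>. real_distribution \<mu> \<and> symmetric_measure \<mu> \<and> measure \<mu> {0} = 0 \<and>
                (\<forall>z. char \<mu> z = complex_of_real (J z)))"
    unfolding real_cf_def
    using symmetric_measure_if_real_char no_atom_at_zero_if_char_vanishes[OF _ _ J_at_top] by metis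
  with main real_cf_integral_nonneg show ?thesis by blast
qed

end
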